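(* Let $m,q,s$ be positive integers with $s>(m-1)q$, and set $n_0=\max\{mq,s\}$. For each $\beta\in(0,1)$, there is a real row-stochastic matrix of order $n_0$ having every nonzero solution $\lambda\in\mathbb C$ of $$\lambda^s(\lambda^q-\beta)^m=(1-\beta)^m\lambda^{mq}$$ as an eigenvalue. More generally, for any $\boldsymbol\beta=(\beta_0,\ldots,\beta_{m-1})\in[0,1]^m$, with $\alpha_j=1-\beta_j$, there is a row-stochastic matrix $A(\boldsymbol\beta)$ of order $n_0$ with $$\det(tI-A(\boldsymbol\beta))=t^{n_0-mq}\prod_{j=0}^{m-1}(t^q-\beta_j)-t^{n_0-s}\prod_{j=0}^{m-1}\alpha_j .$$ Every entry of $A(\boldsymbol\beta)$ is $0$, $1$, $\beta_j$, or $1-\beta_j$ for some $j$, so the matrix depends continuously on $\boldsymbol\beta$. Taking all $\beta_j=\beta$ gives the matrix in the first assertion.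
   Context: A row-stochastic matrix is a real square matrix with nonnegative entries and all row sums equal to $1$. The pattern of entries (which entry is $0$, $1$, $\beta_j$ or $1-\beta_j$) of the family $A(\boldsymbol\beta)$ is fixed for given $m,q,s$, independently of $\boldsymbol\beta$ (in the case $m=1$, $s=q$ the matrix is a fixed permutation matrix). *)

theory Defs
  imports
    "HOL-Analysis.Function_Topology"
    "Jordan_Normal_Form.Char_Poly"
begin

definition row_stochastic :: "nat \<Rightarrow> real mat \<Rightarrow> bool" where
  "row_stochastic n A \<longleftrightarrow>
     A \<in> carrier_mat n n \<and>
     (\<forall>i<n. \<forall>k<n. 0 \<le> A $$ (i, k)) \<and>
     (\<forall>i<n. (\<Sum>k<n. A $$ (i, k)) = 1)"

text \<open>
  A parameter vector in $[0,1]^m$ is a function on \<^typ>\<open>nat\<close> of which only the values at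
  $0, \ldots, m-1$ are constrained; the topology on such functions is the product topology.
\<close>

abbreviation unit_cube :: "nat \<Rightarrow> (nat \<Rightarrow> real) set" where
  "unit_cube m \<equiv> {..<m} \<rightarrow> {0..1}"

text \<open>
  The disjunction over the four kinds of entry stands outside the quantifier over the parameter:
  the kind of each entry, and the index \<open>j\<close>, do not depend on \<open>\<beta>\<close>.
\<close>

definition fixed_entry_pattern :: "nat \<Rightarrow> nat \<Rightarrow> ((nat \<Rightarrow> real) \<Rightarrow> real mat) \<Rightarrow> bool" where
  "fixed_entry_pattern n m A \<longleftrightarrow>
     (\<forall>i<n. \<forall>k<n.
        (\<forall>\<beta>\<in>unit_cube m. A \<beta> $$ (i, k) = 0) \<or>
        (\<forall>\<beta>\<in>unit_cube m. A \<beta> $$ (i, k) = 1) \<or>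
        (\<exists>j<m. \<forall>\<beta>\<in>unit_cube m. A \<beta> $$ (i, k) = \<beta> j) \<or>
        (\<exists>j<m. \<forall>\<beta>\<in>unit_cube m. A \<beta> $$ (i, k) = 1 - \<beta> j))"

end

theory Submission
  imports Defs
begin

text \<open>
  \<open>A(\<beta>)\<close> is the transition matrix of a walk on \<open>m\<close> directed rings of \<open>q\<close> vertices arranged in a row,
  followed by a path of \<open>s - mq\<close> further vertices if \<open>s > mq\<close>. At the last vertex of ring \<open>j\<close> the walk
  returns to the start of the ring with probability \<open>\<beta>\<^sub>j\<close> and moves on with probability
  \<open>1 - \<beta>\<^sub>j\<close>; from the very last vertex it moves on to vertex \<open>n\<^sub>0 - s\<close>. Because
  \<open>s > (m - 1)q\<close>, that vertex lies in the first ring, so the only cycles are the \<open>m\<close> rings and one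
  cycle of length \<open>s\<close> that meets all of them; this gives the two terms of the characteristic
  polynomial. The determinant itself is computed from the recurrence for leading principal minors of
  a lower Hessenberg matrix: the ring edges give the first term, the wrap-around edge the second.
\<close>

section \<open>Determinants of lower Hessenberg matrices\<close>

text \<open>Expansion along the last column leaves two terms, since only the last two rows can be
  nonzero there. One cofactor is a leading minor; the other is, up to sign, a lower Hessenberg
  determinant one size smaller, to which the induction hypothesis applies because \<open>f\<close>
  is generalized.\<close>

lemma det_lower_hessenberg_Suc:
  fixes f :: "nat \<Rightarrow> nat \<Rightarrow> 'a :: comm_ring_1"
  assumes "\<And>i k. i < n \<Longrightarrow> Suc i < k \<Longrightarrow> f i k = 0"
  shows "det (mat (Suc n) (Suc n) (\<lambda>(i, k). f i k)) =
    (\<Sum>k\<le>n. f n k * (\<Prod>j\<in>{k..<n}. - f j (Suc j)) * det (mat k k (\<lambda>(i, k). f i k)))"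
  using assms
proof (induction n arbitrary: f)
  case 0
  show ?case by (subst det_single) auto
next
  case (Suc n)
  let ?M = "mat (Suc (Suc n)) (Suc (Suc n)) (\<lambda>(i, k). f i k)"
  \<comment> \<open>Deleting row \<open>n\<close> and the last column moves row \<open>Suc n\<close>
    into place \<open>n\<close>. The hypothesis leaves the last row unconstrained, so
    \<open>g\<close> still satisfies it.\<close>
  define g where "g = (\<lambda>i. if i = n then f (Suc n) else f i)"
  have "det ?M = (\<Sum>i<Suc (Suc n). ?M $$ (i, Suc n) * cofactor ?M i (Suc n))"
    by (rule laplace_expansion_column) auto
  also have "\<dots> = ?M $$ (n, Suc n) * cofactor ?M n (Suc n) +
      ?M $$ (Suc n, Suc n) * cofactor ?M (Suc n) (Suc n)"
    using Suc.prems by simp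
  also have "cofactor ?M n (Suc n) = - det (mat (Suc n) (Suc n) (\<lambda>(i, k). g i k))"
  proof -
    have "mat_delete ?M n (Suc n) = mat (Suc n) (Suc n) (\<lambda>(i, k). g i k)"
      by (rule eq_matI) (auto simp: mat_delete_def g_def less_Suc_eq)
    then show ?thesis by (simp add: cofactor_def)
  qed
  also have "cofactor ?M (Suc n) (Suc n) = det (mat (Suc n) (Suc n) (\<lambda>(i, k). f i k))"
  proof -
    have "mat_delete ?M (Suc n) (Suc n) = mat (Suc n) (Suc n) (\<lambda>(i, k). f i k)"
      by (rule eq_matI) (auto simp: mat_delete_def)
    then show ?thesis by (simp add: cofactor_def)
  qed
  also have "det (mat (Suc n) (Suc n) (\<lambda>(i, k). g i k)) =
      (\<Sum>k\<le>n. f (Suc n) k * (\<Prod>j\<in>{k..<n}. - f j (Suc j)) * det (mat k k (\<lambda>(i, k). f i k)))"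
  proof -
    have minor: "mat k k (\<lambda>(i, k). g i k) = mat k k (\<lambda>(i, k). f i k)" if "k \<le> n" for k
      using that by (intro eq_matI) (auto simp: g_def)
    have row: "g n = f (Suc n)" "\<And>j. j < n \<Longrightarrow> g j = f j"
      by (auto simp: g_def)
    have "det (mat (Suc n) (Suc n) (\<lambda>(i, k). g i k)) =
        (\<Sum>k\<le>n. g n k * (\<Prod>j\<in>{k..<n}. - g j (Suc j)) * det (mat k k (\<lambda>(i, k). g i k)))"
      using Suc.prems by (intro Suc.IH) (auto simp: g_def)
    also have "\<dots> = (\<Sum>k\<le>n. f (Suc n) k * (\<Prod>j\<in>{k..<n}. - f j (Suc j)) *
        det (mat k k (\<lambda>(i, k). f i k)))"
      by (intro sum.cong refl arg_cong2[where f = "(*)"] prod.cong) (auto simp: row minor)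
    finally show ?thesis .
  qed
  finally show ?case
    by (simp add: sum_distrib_left sum_negf[symmetric] mult_ac prod.atLeastLessThan_Suc)
qed

section \<open>The open walk and its determinant\<close>

text \<open>The values lie in an arbitrary commutative ring so that the same weights serve for real
  and complex matrices and for the polynomial matrix behind \<open>char_poly\<close>.\<close>

definition forward_weight :: "nat \<Rightarrow> nat \<Rightarrow> (nat \<Rightarrow> 'a :: comm_ring_1) \<Rightarrow> nat \<Rightarrow> 'a" where
  "forward_weight m q b i = (if i < m * q \<and> q dvd Suc i then 1 - b (i div q) else 1)"

definition return_weight :: "nat \<Rightarrow> nat \<Rightarrow> (nat \<Rightarrow> 'a :: comm_ring_1) \<Rightarrow> nat \<Rightarrow> nat \<Rightarrow> 'a" where
  "return_weight m q b i k =
     (if i < m * q \<and> q dvd Suc i \<and> Suc i = k + q then b (i div q) else 0)"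

text \<open>
  The entries of \<open>tI - A\<close> for the walk without the wrap-around edge from its last vertex; they do
  not depend on the order of the matrix.
\<close>

definition open_char :: "'a :: comm_ring_1 \<Rightarrow> nat \<Rightarrow> nat \<Rightarrow> (nat \<Rightarrow> 'a) \<Rightarrow> nat \<Rightarrow> nat \<Rightarrow> 'a" where
  "open_char t m q b i k =
     (if i = k then t else 0) - (if k = Suc i then forward_weight m q b i else 0)
     - return_weight m q b i k"

text \<open>The number \<open>min m (n div q)\<close> counts the rings completed by the first
  \<open>n\<close> vertices. In the Hessenberg recurrence a new vertex multiplies the determinant by
  \<open>t\<close>; one that closes ring \<open>r\<close> also subtracts \<open>b r\<close> times
  the determinant belonging to the vertices before that ring, which turns \<open>t ^ q\<close> into
  \<open>t ^ q - b r\<close>.\<close>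

lemma det_open_char:
  fixes t :: "'a :: comm_ring_1"
  assumes q: "q > 0"
  shows "det (mat n n (\<lambda>(i, k). open_char t m q b i k)) =
    t ^ (n - q * min m (n div q)) * (\<Prod>j<min m (n div q). t ^ q - b j)"
proof (induction n rule: less_induct)
  case (less n)
  show ?case
  proof (cases n)
    case 0
    then show ?thesis by simp
  next
    case (Suc p)
    let ?f = "open_char t m q b"
    let ?D = "\<lambda>k. det (mat k k (\<lambda>(i, k). ?f i k))"
    let ?c = "min m (p div q)"
    have "?D n = (\<Sum>k\<le>p. ?f p k * (\<Prod>j\<in>{k..<p}. - ?f j (Suc j)) * ?D k)"
      unfolding Suc using q
      by (intro det_lower_hessenberg_Suc) (auto simp: open_char_def return_weight_def)
    also have "\<dots> = (\<Sum>k\<le>p. (if p = k then t * ?D p else 0)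
        - return_weight m q b p k * (\<Prod>j\<in>{k..<p}. forward_weight m q b j) * ?D k)"
    proof (intro sum.cong refl)
      fix k assume k: "k \<in> {..p}"
      have "(\<Prod>j\<in>{k..<p}. - ?f j (Suc j)) = (\<Prod>j\<in>{k..<p}. forward_weight m q b j)"
        using q by (intro prod.cong refl) (auto simp: open_char_def return_weight_def)
      moreover have "?f p k = (if p = k then t else 0) - return_weight m q b p k"
        using k by (auto simp: open_char_def)
      ultimately show "?f p k * (\<Prod>j\<in>{k..<p}. - ?f j (Suc j)) * ?D k = (if p = k then t * ?D p else 0)
        - return_weight m q b p k * (\<Prod>j\<in>{k..<p}. forward_weight m q b j) * ?D k"
        by (auto simp: left_diff_distrib)
    qed
    also have "\<dots> = t * ?D p
        - (\<Sum>k\<le>p. return_weight m q b p k * (\<Prod>j\<in>{k..<p}. forward_weight m q b j) * ?D k)"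
      by (simp add: sum_subtractf)
    finally have rec: "?D n = t * ?D p
        - (\<Sum>k\<le>p. return_weight m q b p k * (\<Prod>j\<in>{k..<p}. forward_weight m q b j) * ?D k)" .
    have Dp: "?D p = t ^ (p - q * ?c) * (\<Prod>j<?c. t ^ q - b j)"
      using Suc by (intro less.IH) simp
    show ?thesis
    proof (cases "p < m * q \<and> q dvd Suc p")
      case True
      \<comment> \<open>Here \<open>p\<close> is the last vertex of ring \<open>r\<close>, and its
        return edge leads to the ring's first vertex \<open>q * r\<close>, the only column that
        contributes to the sum.\<close>
      define r where "r = p div q"
      have p: "Suc p = q * r + q" 
      proof -
        obtain c where c: "Suc p = q * c" using True by (auto elim: dvdE)
        then have "c > 0" by (cases c) auto
        then obtain d where d: "c = Suc d" by (cases c) auto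
        have pd: "p = q * d + (q - 1)" using c d q by simp
        have "p div q = d" unfolding pd using q by (intro div_nat_eqI) simp_all
        then show ?thesis using c d by (simp add: r_def)
      qed
      then have rm: "r < m" using True q by (simp add: r_def div_less_iff_less_mult)
      have nr: "n div q = Suc r" using p q by (simp add: Suc)
      have "(\<Sum>k\<le>p. return_weight m q b p k * (\<Prod>j\<in>{k..<p}. forward_weight m q b j) * ?D k)
          = (\<Sum>k\<in>{q * r}. return_weight m q b p k * (\<Prod>j\<in>{k..<p}. forward_weight m q b j) * ?D k)"
        using p q by (intro sum.mono_neutral_right) (auto simp: return_weight_def)
      also have "\<dots> = b r * (\<Prod>j\<in>{q * r..<p}. forward_weight m q b j) * ?D (q * r)"
        using True p by (simp add: return_weight_def r_def)
      \<comment> \<open>Inside ring \<open>r\<close> the walk branches only at \<open>p\<close>,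
        which the product excludes.\<close>
      also have "(\<Prod>j\<in>{q * r..<p}. forward_weight m q b j) = 1"
      proof (intro prod.neutral ballI)
        fix j assume j: "j \<in> {q * r..<p}"
        have "\<not> q dvd Suc j"
        proof
          assume "q dvd Suc j"
          then have "q dvd Suc j - q * r" by (intro dvd_diff_nat) auto
          then have "q \<le> Suc j - q * r" using j by (intro dvd_imp_le) auto
          then show False using j p by (auto simp: le_diff_conv2)
        qed
        then show "forward_weight m q b j = 1" by (simp add: forward_weight_def)
      qed
      also have "?D (q * r) = (\<Prod>j<r. t ^ q - b j)"
        using p q Suc rm by (subst less.IH) auto
      finally have sum: "(\<Sum>k\<le>p. return_weight m q b p k *
          (\<Prod>j\<in>{k..<p}. forward_weight m q b j) * ?D k) = b r * (\<Prod>j<r. t ^ q - b j)"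
        by simp
      have c: "?c = r" using rm by (simp add: r_def)
      have "t * t ^ (p - q * r) = t ^ q"
      proof -
        have "p - q * r = q - 1" using p by simp
        then show ?thesis using q by (simp add: power_eq_if[of t q])
      qed
      then have tD: "t * ?D p = t ^ q * (\<Prod>j<r. t ^ q - b j)"
        unfolding Dp c by (simp add: mult.assoc[symmetric])
      have "min m (n div q) = Suc r" using rm nr by simp
      moreover have "n - q * Suc r = 0" using p Suc by simp
      ultimately show ?thesis
        unfolding rec sum tD by (simp only: prod.lessThan_Suc) (simp add: algebra_simps)
    next
      case False
      then have "return_weight m q b p k = 0" for k by (auto simp: return_weight_def)
      then have Dn: "?D n = t * ?D p" unfolding rec by simp
      \<comment> \<open>No ring is completed at \<open>p\<close>: either all \<open>m\<close> rings
        are complete already, or \<open>Suc p\<close> is not a multiple of \<open>q\<close>.\<close>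
      have "min m (n div q) = ?c"
      proof (cases "q dvd Suc p")
        case True
        then have "m * q \<le> p" using False by simp
        then have "m \<le> p div q" "m \<le> n div q"
          using q by (simp_all add: less_eq_div_iff_mult_less_eq Suc)
        then show ?thesis by simp
      next
        case False
        then show ?thesis by (simp add: Suc div_Suc mod_eq_0_iff_dvd)
      qed
      moreover have "q * ?c \<le> p" 
        by (metis min.cobounded2 mult_le_mono2 order_trans times_div_less_eq_dividend)
      ultimately show ?thesis
        unfolding Dn Dp by (simp add: Suc Suc_diff_le mult.assoc)
    qed
  qed
qed

section \<open>Closing the walk: the characteristic polynomial\<close>

text \<open>Only the ring ends \<open>q * j + (q - 1)\<close> can have a weight other than
  \<open>1\<close>. The bound \<open>a < q\<close> keeps the end of the first ring in range, so
  every ring contributes its factor.\<close>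

lemma prod_forward_weight:
  assumes q: "q > 0" and a: "a < q" and n: "m * q \<le> n"
  shows "(\<Prod>i\<in>{a..<n}. forward_weight m q b i) = (\<Prod>j<m. 1 - b j)"
proof -
  let ?e = "\<lambda>j. q * j + (q - 1)"
  have "(\<Prod>i\<in>{a..<n}. forward_weight m q b i) = (\<Prod>i\<in>?e ` {..<m}. forward_weight m q b i)"
  proof (intro prod.mono_neutral_right ballI)
    show "?e ` {..<m} \<subseteq> {a..<n}"
    proof
      fix i assume "i \<in> ?e ` {..<m}"
      then obtain j where j: "j < m" "i = ?e j" by auto
      have "q * Suc j \<le> m * q" using j by (metis Suc_leI mult.commute mult_le_mono1)
      then have "?e j < n" using q n by simp
      moreover have "a \<le> ?e j" using a by simp
      ultimately show "i \<in> {a..<n}" using j by simp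
    qed
    fix i assume i: "i \<in> {a..<n} - ?e ` {..<m}"
    have "\<not> (i < m * q \<and> q dvd Suc i)"
    proof
      assume *: "i < m * q \<and> q dvd Suc i"
      then obtain c where c: "Suc i = q * c" by (auto elim: dvdE)
      then obtain d where d: "c = Suc d" by (cases c) auto
      have id: "i = ?e d" using c d q by simp
      moreover have "d < m"
      proof -
        have "q * d \<le> i" using id by simp
        then have "q * d < m * q" using * by linarith
        then show ?thesis by (simp add: mult.commute[of m])
      qed
      ultimately show False using i by auto
    qed
    then show "forward_weight m q b i = 1" by (simp only: forward_weight_def if_False)
  qed auto
  also have "\<dots> = (\<Prod>j<m. forward_weight m q b (?e j))"
  proof -
    have "inj_on ?e {..<m}"
    proof (rule inj_onI)
      fix x y assume "?e x = ?e y"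
      then have "q * x = q * y" by (simp only: add_right_cancel)
      then show "x = y" using q by simp
    qed
    then show ?thesis by (simp add: prod.reindex)
  qed
  also have "\<dots> = (\<Prod>j<m. 1 - b j)"
  proof (intro prod.cong refl)
    fix j assume "j \<in> {..<m}"
    then have "q * Suc j \<le> q * m" by (intro mult_le_mono) auto
    then have "?e j < m * q" using q by (simp add: mult.commute)
    moreover have "q dvd Suc (?e j)" using q by simp
    moreover have "?e j div q = j" using q by (intro div_nat_eqI) simp_all
    ultimately show "forward_weight m q b (?e j) = 1 - b j" by (simp add: forward_weight_def)
  qed
  finally show ?thesis .
qed

text \<open>The two kinds of edge are added because for \<open>m = 1\<close> and
  \<open>s = q\<close> the wrap-around edge and the ring edge occupy the same entry.\<close>

definition ring_matrix :: "nat \<Rightarrow> nat \<Rightarrow> nat \<Rightarrow> nat \<Rightarrow> (nat \<Rightarrow> 'a :: comm_ring_1) \<Rightarrow> 'a mat" where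
  "ring_matrix n m q s b = mat n n (\<lambda>(i, k).
     (if k = (if Suc i < n then Suc i else n - s) then forward_weight m q b i else 0)
     + return_weight m q b i k)"

text \<open>The wrap-around edge alters only the entry \<open>(n - 1, n - s)\<close> of the open
  matrix. The Hessenberg sum is linear in the last row, and its minors and superdiagonal products do
  not involve that row, so the determinant changes by a single summand.\<close>

lemma det_ring_matrix:
  fixes t :: "'a :: comm_ring_1"
  assumes "q > 0" "s > 0" "m * q \<le> n" "s \<le> n" "n < s + q"
  shows "det (t \<cdot>\<^sub>m 1\<^sub>m n - ring_matrix n m q s b) =
    t ^ (n - m * q) * (\<Prod>j<m. t ^ q - b j) - t ^ (n - s) * (\<Prod>j<m. 1 - b j)"
proof -
  obtain p where p: "n = Suc p" using assms by (cases n) auto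
  let ?g = "open_char t m q b"
  let ?a = "n - s"
  define f where "f i k = ?g i k - (if i = p \<and> k = ?a then forward_weight m q b p else 0)" for i k
  have aq: "?a < q" and ap: "?a \<le> p" using assms p by auto
  \<comment> \<open>In row \<open>p\<close> the forward entry of \<open>open_char\<close> would be
    in column \<open>Suc p\<close>, outside the matrix; the correction in \<open>f\<close> puts it
    in column \<open>n - s\<close>.\<close>
  have "t \<cdot>\<^sub>m 1\<^sub>m n - ring_matrix n m q s b = mat n n (\<lambda>(i, k). f i k)"
    using ap by (intro eq_matI)
      (auto simp: ring_matrix_def f_def open_char_def p less_Suc_eq algebra_simps)
  then have "det (t \<cdot>\<^sub>m 1\<^sub>m n - ring_matrix n m q s b) = det (mat n n (\<lambda>(i, k). f i k))"
    by simp
  also have "\<dots> = (\<Sum>k\<le>p. f p k * (\<Prod>j\<in>{k..<p}. - f j (Suc j)) * det (mat k k (\<lambda>(i, k). f i k)))"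
    unfolding p using assms
    by (intro det_lower_hessenberg_Suc) (auto simp: f_def open_char_def return_weight_def)
  also have "\<dots> = (\<Sum>k\<le>p. f p k * (\<Prod>j\<in>{k..<p}. - ?g j (Suc j)) * det (mat k k (\<lambda>(i, k). ?g i k)))"
    by (intro sum.cong refl arg_cong2[where f = "(*)"] prod.cong arg_cong[where f = det] eq_matI)
       (auto simp: f_def)
  also have "\<dots> = (\<Sum>k\<le>p. ?g p k * (\<Prod>j\<in>{k..<p}. - ?g j (Suc j)) * det (mat k k (\<lambda>(i, k). ?g i k)))
    - (\<Sum>k\<le>p. if k = ?a then forward_weight m q b p * (\<Prod>j\<in>{?a..<p}. - ?g j (Suc j)) *
        det (mat ?a ?a (\<lambda>(i, k). ?g i k)) else 0)"
    unfolding sum_subtractf[symmetric]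
    by (intro sum.cong refl) (auto simp: f_def algebra_simps)
  also have "(\<Sum>k\<le>p. ?g p k * (\<Prod>j\<in>{k..<p}. - ?g j (Suc j)) * det (mat k k (\<lambda>(i, k). ?g i k)))
    = det (mat n n (\<lambda>(i, k). ?g i k))"
    unfolding p using assms
    by (intro det_lower_hessenberg_Suc[symmetric]) (auto simp: open_char_def return_weight_def)
  also have "\<dots> = t ^ (n - m * q) * (\<Prod>j<m. t ^ q - b j)"
  proof -
    have "m \<le> n div q" using assms by (simp add: less_eq_div_iff_mult_less_eq)
    then show ?thesis
      using assms by (simp add: det_open_char min_absorb1 mult.commute)
  qed
  also have "(\<Sum>k\<le>p. if k = ?a then forward_weight m q b p * (\<Prod>j\<in>{?a..<p}. - ?g j (Suc j)) *
        det (mat ?a ?a (\<lambda>(i, k). ?g i k)) else 0) =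
      forward_weight m q b p * (\<Prod>j\<in>{?a..<p}. - ?g j (Suc j)) *
        det (mat ?a ?a (\<lambda>(i, k). ?g i k))"
    using ap by simp
  \<comment> \<open>Since \<open>n - s < q\<close>, the vertices before the wrap-around target
    complete no ring.\<close>
  also have "det (mat ?a ?a (\<lambda>(i, k). ?g i k)) = t ^ ?a"
    using aq assms by (simp add: det_open_char)
  also have "forward_weight m q b p * (\<Prod>j\<in>{?a..<p}. - ?g j (Suc j)) =
      (\<Prod>j\<in>{?a..<n}. forward_weight m q b j)"
  proof -
    have "(\<Prod>j\<in>{?a..<p}. - ?g j (Suc j)) = (\<Prod>j\<in>{?a..<p}. forward_weight m q b j)"
      using assms by (intro prod.cong refl) (auto simp: open_char_def return_weight_def)
    then show ?thesis using ap by (simp add: p prod.atLeastLessThan_Suc mult.commute)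
  qed
  also have "\<dots> = (\<Prod>j<m. 1 - b j)"
    using assms aq by (intro prod_forward_weight) auto
  finally show ?thesis by (simp add: mult.commute)
qed

text \<open>This is the determinant formula over the polynomial ring, with \<open>t\<close> the
  indeterminate and the parameters taken as constant polynomials.\<close>

lemma char_poly_ring_matrix:
  fixes b :: "nat \<Rightarrow> 'a :: comm_ring_1"
  assumes "q > 0" "s > 0" "m * q \<le> n" "s \<le> n" "n < s + q"
  shows "char_poly (ring_matrix n m q s b) =
    monom 1 (n - m * q) * (\<Prod>j<m. monom 1 q - [:b j:]) - monom 1 (n - s) * [:\<Prod>j<m. 1 - b j:]"
proof -
  have const: "(\<Prod>j<m. 1 - [:b j:]) = [:\<Prod>j<m. 1 - b j:]"
    by (induction m) (auto simp: one_pCons mult.commute)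
  have weights: "forward_weight m q (\<lambda>j. [:b j:]) i = [:forward_weight m q b i:]"
      "return_weight m q (\<lambda>j. [:b j:]) i k = [:return_weight m q b i k:]" for i k
    by (auto simp: forward_weight_def return_weight_def one_pCons)
  have "char_poly_matrix (ring_matrix n m q s b) =
      [:0, 1:] \<cdot>\<^sub>m 1\<^sub>m n - ring_matrix n m q s (\<lambda>j. [:b j:])"
    by (intro eq_matI)
       (auto simp: char_poly_matrix_def ring_matrix_def weights)
  then show ?thesis
    unfolding char_poly_def using assms
    by (simp add: det_ring_matrix const monom_altdef)
qed

section \<open>Permutation case, stochasticity, entries and continuity\<close>

text \<open>At the last vertex the forward and return edges both lead to \<open>0\<close>, and their
  weights \<open>1 - b 0\<close> and \<open>b 0\<close> add up to \<open>1\<close>.\<close>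

lemma ring_matrix_permutation:
  assumes "q > 0"
  shows "ring_matrix q 1 q q b = mat q q (\<lambda>(i, k). if Suc i mod q = k then 1 else 0)"
proof (intro eq_matI)
  fix i k assume "i < dim_row (mat q q (\<lambda>(i, k). if Suc i mod q = k then 1 else (0::'a)))"
    and "k < dim_col (mat q q (\<lambda>(i, k). if Suc i mod q = k then 1 else (0::'a)))"
  then have ik: "i < q" "k < q" by auto
  show "ring_matrix q 1 q q b $$ (i, k) =
      mat q q (\<lambda>(i, k). if Suc i mod q = k then 1 else 0) $$ (i, k)"
  proof (cases "Suc i = q")
    case True
    then show ?thesis using ik
      by (auto simp: ring_matrix_def forward_weight_def return_weight_def)
  next
    case False
    then have "Suc i < q" using ik by simp
    moreover from this have "\<not> q dvd Suc i" by (simp add: nat_dvd_not_less)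
    ultimately show ?thesis using ik
      by (auto simp: ring_matrix_def forward_weight_def return_weight_def)
  qed
qed (simp_all add: ring_matrix_def)

lemma cyclic_shift_permutes:
  assumes "n > 0"
  shows "(\<lambda>i. if i < n then Suc i mod n else i) permutes {..<n}"
proof (rule bij_imp_permutes)
  let ?p = "\<lambda>i. if i < n then Suc i mod n else i"
  have "inj_on ?p {..<n}"
    by (auto simp: inj_on_def mod_Suc split: if_splits)
  moreover have "?p ` {..<n} \<subseteq> {..<n}" using assms by auto
  ultimately show "bij_betw ?p {..<n} {..<n}"
    unfolding bij_betw_def using endo_inj_surj[OF finite_lessThan] by blast
qed auto

lemma row_stochastic_ring_matrix:
  assumes "q > 0" "s > 0" "\<beta> \<in> unit_cube m"
  shows "row_stochastic n (ring_matrix n m q s \<beta>)"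
  unfolding row_stochastic_def
proof (intro conjI allI impI)
  show "ring_matrix n m q s \<beta> \<in> carrier_mat n n" by (simp add: ring_matrix_def)
next
  fix i k assume ik: "i < n" "k < n"
  have "0 \<le> \<beta> (i div q) \<and> \<beta> (i div q) \<le> 1" if "i < m * q"
    using assms(3) less_mult_imp_div_less[OF that] by (auto simp: Pi_iff)
  then show "0 \<le> ring_matrix n m q s \<beta> $$ (i, k)"
    using ik by (auto simp: ring_matrix_def forward_weight_def return_weight_def)
next
  fix i assume i: "i < n"
  let ?next = "if Suc i < n then Suc i else n - s"
  have "(\<Sum>k<n. ring_matrix n m q s \<beta> $$ (i, k)) =
      (\<Sum>k<n. (if k = ?next then forward_weight m q \<beta> i else 0) + return_weight m q \<beta> i k)"
    using i by (simp add: ring_matrix_def)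
  also have "\<dots> = forward_weight m q \<beta> i + (\<Sum>k<n. return_weight m q \<beta> i k)"
    using i assms by (simp add: sum.distrib)
  also have "(\<Sum>k<n. return_weight m q \<beta> i k) =
      (if i < m * q \<and> q dvd Suc i then \<beta> (i div q) else 0)"
  proof (cases "i < m * q \<and> q dvd Suc i")
    case True
    then have "q \<le> Suc i" by (auto intro: dvd_imp_le)
    then have "(\<Sum>k<n. return_weight m q \<beta> i k) =
        (\<Sum>k<n. if k = Suc i - q then \<beta> (i div q) else 0)"
      using True by (intro sum.cong) (auto simp: return_weight_def)
    also have "\<dots> = \<beta> (i div q)" using i assms by simp
    finally show ?thesis using True by simp
  next
    case False
    then have "return_weight m q \<beta> i k = 0" for k by (auto simp: return_weight_def)
    then show ?thesis using False by auto
  qed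
  finally show "(\<Sum>k<n. ring_matrix n m q s \<beta> $$ (i, k)) = 1"
    by (simp add: forward_weight_def)
qed

lemma fixed_entry_pattern_ring_matrix:
  assumes "m > 0" "q > 0" "s > 0" "s > (m - 1) * q" "n = max (m * q) s"
  shows "fixed_entry_pattern n m (ring_matrix n m q s)"
\<comment> \<open>In this case one entry is a sum of two nonconstant weights, so it is identified as
  \<open>1\<close> through the permutation form. Otherwise every entry is a single weight or
  \<open>0\<close>.\<close>
proof (cases "m = 1 \<and> s = q")
  case True
  then have "ring_matrix n m q s b = mat q q (\<lambda>(i, k). if Suc i mod q = k then 1 else (0::real))" for b
    using assms ring_matrix_permutation[of q b] by simp
  then show ?thesis
    using True assms by (simp add: fixed_entry_pattern_def)
next
  case False
  show ?thesis
    unfolding fixed_entry_pattern_def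
  proof (intro allI impI)
    fix i k assume ik: "i < n" "k < n"
    let ?next = "if Suc i < n then Suc i else n - s"
    let ?branch = "i < m * q \<and> q dvd Suc i"
    have entry: "ring_matrix n m q s \<beta> $$ (i, k) =
        (if k = ?next then forward_weight m q \<beta> i else 0) + return_weight m q \<beta> i k" for \<beta> :: "nat \<Rightarrow> real"
      using ik by (simp add: ring_matrix_def)
    \<comment> \<open>The ring edge and the wrap-around edge coincide only if \<open>m = 1\<close> and \<open>s = q\<close>.\<close>
    have disjoint: "k \<noteq> ?next" if "?branch" "Suc i = k + q"
    proof
      assume *: "k = ?next"
      then have i: "Suc i = n" and k: "k = n - s"
        using that ik assms(2) by (auto split: if_splits)
      then have "n = m * q" using that(1) assms by auto
      then have "s = q" using k i that(2) assms by auto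
      then have "m = 1" using assms by (cases m) auto
      with \<open>s = q\<close> False show False by simp
    qed
    have j: "i div q < m" if "?branch"
      using that less_mult_imp_div_less by blast
    consider "?branch" "Suc i = k + q" | "?branch" "k = ?next" "Suc i \<noteq> k + q"
      | "\<not> ?branch" "k = ?next" | "k \<noteq> ?next" "\<not> (?branch \<and> Suc i = k + q)"
      by blast
    then show "(\<forall>\<beta>\<in>unit_cube m. ring_matrix n m q s \<beta> $$ (i, k) = 0) \<or>
        (\<forall>\<beta>\<in>unit_cube m. ring_matrix n m q s \<beta> $$ (i, k) = 1) \<or>
        (\<exists>j<m. \<forall>\<beta>\<in>unit_cube m. ring_matrix n m q s \<beta> $$ (i, k) = \<beta> j) \<or>
        (\<exists>j<m. \<forall>\<beta>\<in>unit_cube m. ring_matrix n m q s \<beta> $$ (i, k) = 1 - \<beta> j)"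
    proof cases
      case 1
      then have "ring_matrix n m q s \<beta> $$ (i, k) = \<beta> (i div q)" for \<beta> :: "nat \<Rightarrow> real"
        using disjoint by (simp only: entry return_weight_def if_True if_False) simp
      then show ?thesis using j 1 by blast
    next
      case 2
      have "ring_matrix n m q s \<beta> $$ (i, k) = 1 - \<beta> (i div q)" for \<beta> :: "nat \<Rightarrow> real"
        unfolding entry using 2 by (auto simp: return_weight_def forward_weight_def)
      then show ?thesis using j 2 by blast
    next
      case 3
      have "ring_matrix n m q s \<beta> $$ (i, k) = 1" for \<beta> :: "nat \<Rightarrow> real"
        unfolding entry using 3 by (auto simp: return_weight_def forward_weight_def)
      then show ?thesis by blast
    next
      case 4
      then have "\<not> (i < m * q \<and> q dvd Suc i \<and> Suc i = k + q)" by blast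
      then have "ring_matrix n m q s \<beta> $$ (i, k) = 0" for \<beta> :: "nat \<Rightarrow> real"
        unfolding entry return_weight_def if_not_P[OF 4(1)] by (simp only: if_False add_0_right)
      then show ?thesis by blast
    qed
  qed
qed

lemma fixed_entry_pattern_continuous:
  assumes "fixed_entry_pattern n m A" "i < n" "k < n"
  shows "continuous_on (unit_cube m) (\<lambda>\<beta>. A \<beta> $$ (i, k))"
proof -
  have coordinate: "continuous_on (unit_cube m) (\<lambda>\<beta>. \<beta> j)" for j
    by (rule continuous_on_subset[OF continuous_on_product_coordinates]) simp
  \<comment> \<open>The entries are known only on the cube, so continuity is transferred there from
    a constant or an affine function of one coordinate.\<close>
  have cong: "continuous_on (unit_cube m) (\<lambda>\<beta>. A \<beta> $$ (i, k))"
    if "continuous_on (unit_cube m) h" "\<forall>\<beta>\<in>unit_cube m. A \<beta> $$ (i, k) = h \<beta>" for h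
    using that by (subst continuous_on_cong[OF refl]) auto
  consider "\<forall>\<beta>\<in>unit_cube m. A \<beta> $$ (i, k) = 0" | "\<forall>\<beta>\<in>unit_cube m. A \<beta> $$ (i, k) = 1"
    | j where "\<forall>\<beta>\<in>unit_cube m. A \<beta> $$ (i, k) = \<beta> j"
    | j where "\<forall>\<beta>\<in>unit_cube m. A \<beta> $$ (i, k) = 1 - \<beta> j"
    using assms unfolding fixed_entry_pattern_def by blast
  then show ?thesis
    by cases (rule cong[rotated], assumption, intro continuous_intros coordinate)+
qed

section \<open>Eigenvalues and the final assembly\<close>

lemma eigenvalue_ring_matrix:
  fixes z :: complex and b :: real
  assumes "q > 0" "s > 0" "m * q \<le> n" "s \<le> n" "n < s + q"
    and z: "z \<noteq> 0" "z ^ s * (z ^ q - of_real b) ^ m = (1 - of_real b) ^ m * z ^ (m * q)"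
  shows "eigenvalue (map_mat complex_of_real (ring_matrix n m q s (\<lambda>_. b))) z"
proof -
  let ?A = "ring_matrix n m q s (\<lambda>_. complex_of_real b)"
  \<comment> \<open>The construction commutes with the embedding of the reals, so the characteristic
    polynomial formula applies directly over the complex numbers.\<close>
  have "map_mat complex_of_real (ring_matrix n m q s (\<lambda>_. b)) = ?A"
    by (intro eq_matI) (auto simp: ring_matrix_def forward_weight_def return_weight_def)
  moreover have "poly (char_poly ?A) z = 0"
  proof -
    have n: "z ^ n = z ^ (n - m * q) * z ^ (m * q)" "z ^ n = z ^ (n - s) * z ^ s"
      using assms by (simp_all add: power_add[symmetric])
    \<comment> \<open>Multiplying by \<open>z ^ s * z ^ (m * q)\<close> completes the exponents
      \<open>n - m * q\<close> and \<open>n - s\<close> to \<open>n\<close> in the respective terms.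
      The given equation then makes them cancel, and \<open>z \<noteq> 0\<close> permits dividing
      back.\<close>
    have "z ^ s * (z ^ (m * q) * poly (char_poly ?A) z) =
        (z ^ (n - m * q) * z ^ (m * q)) * (z ^ s * (z ^ q - of_real b) ^ m)
        - (z ^ (n - s) * z ^ s) * ((1 - of_real b) ^ m * z ^ (m * q))"
      using assms(1-5) by (simp add: char_poly_ring_matrix poly_monom algebra_simps)
    also have "\<dots> = 0" using z(2) n by simp
    finally show ?thesis using z(1) by simp
  qed
  moreover have "?A \<in> carrier_mat n n" by (simp add: ring_matrix_def)
  ultimately show ?thesis by (simp add: eigenvalue_root_char_poly)
qed

theorem theorem5p3:
  fixes m q s n0 :: nat
  assumes "m > 0" and "q > 0" and "s > 0"
    and "s > (m - 1) * q"
    and "n0 = max (m * q) s"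
  shows "(\<forall>b::real. 0 < b \<and> b < 1 \<longrightarrow>
           (\<exists>B. row_stochastic n0 B \<and>
             (\<forall>z::complex. z \<noteq> 0 \<and>
                z ^ s * (z ^ q - of_real b) ^ m = (1 - of_real b) ^ m * z ^ (m * q) \<longrightarrow>
                eigenvalue (map_mat complex_of_real B) z)))
       \<and> (\<exists>A :: (nat \<Rightarrow> real) \<Rightarrow> real mat.
           (\<forall>\<beta>\<in>unit_cube m.
              row_stochastic n0 (A \<beta>) \<and>
              char_poly (A \<beta>) =
                monom 1 (n0 - m * q) * (\<Prod>j<m. monom 1 q - [:\<beta> j:])
                - monom 1 (n0 - s) * [:\<Prod>j<m. 1 - \<beta> j:]) \<and>
           fixed_entry_pattern n0 m A \<and>
           (\<forall>i<n0. \<forall>k<n0. continuous_on (unit_cube m) (\<lambda>\<beta>. A \<beta> $$ (i, k))) \<and>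
           (m = 1 \<and> s = q \<longrightarrow>
              (\<exists>p. p permutes {..<n0} \<and>
                (\<forall>\<beta>\<in>unit_cube m. A \<beta> = mat n0 n0 (\<lambda>(i, k). if p i = k then 1 else 0)))) \<and>
           (\<forall>b::real. 0 < b \<and> b < 1 \<longrightarrow>
             (\<forall>z::complex. z \<noteq> 0 \<and>
                z ^ s * (z ^ q - of_real b) ^ m = (1 - of_real b) ^ m * z ^ (m * q) \<longrightarrow>
                eigenvalue (map_mat complex_of_real (A (\<lambda>_. b))) z)))"
proof -
  define A :: "(nat \<Rightarrow> real) \<Rightarrow> real mat" where "A = ring_matrix n0 m q s"
  \<comment> \<open>With \<open>s > (m - 1) * q\<close> this gives \<open>m * q < s + q\<close>,
    hence \<open>n0 - s < q\<close>: the wrap-around target lies in the first ring.\<close>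
  have "m * q = (m - 1) * q + q" using assms by (cases m) auto
  then have size: "m * q \<le> n0" "s \<le> n0" "n0 < s + q" using assms by auto
  have stochastic: "row_stochastic n0 (A \<beta>)" if "\<beta> \<in> unit_cube m" for \<beta>
    using assms that by (simp add: A_def row_stochastic_ring_matrix)
  have pattern: "fixed_entry_pattern n0 m A"
    using assms by (simp add: A_def fixed_entry_pattern_ring_matrix)
  have spectrum: "eigenvalue (map_mat complex_of_real (A (\<lambda>_. b))) z"
    if "z \<noteq> 0" "z ^ s * (z ^ q - of_real b) ^ m = (1 - of_real b) ^ m * z ^ (m * q)" for b z
    using assms size that by (simp add: A_def eigenvalue_ring_matrix)
  have permutation: "\<exists>p. p permutes {..<n0} \<and>
      (\<forall>\<beta>\<in>unit_cube m. A \<beta> = mat n0 n0 (\<lambda>(i, k). if p i = k then 1 else 0))"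
    if "m = 1 \<and> s = q"
  proof (intro exI conjI ballI)
    have n0: "n0 = q" using that assms by simp
    \<comment> \<open>The cyclic shift is extended by the identity, as \<open>permutes\<close>
      requires outside the index set.\<close>
    show "(\<lambda>i. if i < n0 then Suc i mod n0 else i) permutes {..<n0}"
      using n0 assms by (intro cyclic_shift_permutes) simp
    show "A \<beta> = mat n0 n0
        (\<lambda>(i, k). if (if i < n0 then Suc i mod n0 else i) = k then 1 else 0)" for \<beta>
      using that n0 assms ring_matrix_permutation[of q \<beta>]
      by (auto simp: A_def intro!: eq_matI)
  qed
  show ?thesis
  proof (intro conjI exI[of _ A] allI impI ballI)
    fix b :: real assume b: "0 < b \<and> b < 1"
    then show "\<exists>B. row_stochastic n0 B \<and> (\<forall>z::complex. z \<noteq> 0 \<and>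
        z ^ s * (z ^ q - of_real b) ^ m = (1 - of_real b) ^ m * z ^ (m * q) \<longrightarrow>
        eigenvalue (map_mat complex_of_real B) z)"
      using stochastic[of "\<lambda>_. b"] spectrum by (intro exI[of _ "A (\<lambda>_. b)"]) auto
  next
    show "char_poly (A \<beta>) = monom 1 (n0 - m * q) * (\<Prod>j<m. monom 1 q - [:\<beta> j:])
        - monom 1 (n0 - s) * [:\<Prod>j<m. 1 - \<beta> j:]" for \<beta>
      using assms size by (simp add: A_def char_poly_ring_matrix)
  next
    show "continuous_on (unit_cube m) (\<lambda>\<beta>. A \<beta> $$ (i, k))" if "i < n0" "k < n0" for i k
      using pattern that by (rule fixed_entry_pattern_continuous)
  qed (use stochastic pattern spectrum permutation in auto)
qed

end
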